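(* Let $\{f_\beta:\beta\in\mathcal{B}\}$ be a $p$-parameter exponential family $f_\beta(\hat\beta)=e^{\alpha'\hat\beta-\psi(\alpha)}f_0(\hat\beta)$ indexed by its expectation parameter $\beta$, with $\alpha$ the corresponding canonical parameter. Let $\hat\beta\in\mathcal{B}$ be a fixed observed value with corresponding canonical parameter $\hat\alpha$. Let $V(\alpha)$ be the covariance matrix of the sufficient statistic under $\alpha$, assumed nonsingular, and assume that $$\frac{f_{\hat\beta}(\hat\beta)}{f_\beta(\beta)}=\frac{|V(\alpha)|^{1/2}}{|V(\hat\alpha)|^{1/2}}\qquad\text{for all }\beta\in\mathcal{B}.$$ Let $\beta_1,\ldots,\beta_B\in\mathcal{B}$ be parametric bootstrap replications (draws from $f_{\hat\beta}$), let $t$ be a real-valued function on $\mathcal{B}$, and for a prior density $\pi$ on $\mathcal{B}$ let $$\hat E\{t(\beta)\mid\hat\beta\}=\sum_{i=1}^B t(\beta_i)\pi(\beta_i)R(\beta_i)\Big/\sum_{i=1}^B\pi(\beta_i)R(\beta_i),\qquad R(\beta)=\frac{f_\beta(\hat\beta)}{f_{\hat\beta}(\beta)}.$$ If $\pi$ is Jeffreys prior, $\pi(\beta)=c\,|V(\alpha)|^{-1/2}$ with $c>0$ an arbitrary constant, then $$\hat E\{t(\beta)\mid\hat\beta\}=\sum_{i=1}^B t(\beta_i)e^{\Delta(\beta_i)}\Big/\sum_{i=1}^B e^{\Delta(\beta_i)},$$ where $\Delta(\beta)=[D(\beta,\hat\beta)-D(\hat\beta,\beta)]/2=(\alpha-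\hat\alpha)'(\beta+\hat\beta)-2[\psi(\alpha)-\psi(\hat\alpha)]$.
   Context: Densities are with respect to a fixed dominating measure on $\mathbb{R}^p$, taken positive at the points where they are evaluated. $\psi$ is the cumulant generating function; the canonical parameter $\alpha$ and the expectation parameter $\beta=E_\alpha\{\hat\beta\}=\nabla\psi(\alpha)$ are in one-to-one correspondence, $\mathcal{B}$ is the space of possible expectation vectors, and $V(\alpha)=\nabla^2\psi(\alpha)$ is the covariance matrix of the sufficient statistic. $f_{\hat\beta}(\beta)$ means the density with expectation parameter $\hat\beta$ evaluated at the point $\beta$. The deviance is $D(\beta_1,\beta_2)=2E_{\beta_1}\{\log(f_{\beta_1}/f_{\beta_2})\}$, i.e. $D(\beta_1,\beta_2)/2=(\alpha_1-\alpha_2)'\beta_1-(\psi(\alpha_1)-\psi(\alpha_2))$, where $\alpha_j$ corresponds to $\beta_j$. The prior density may be improper (unnormalized). *)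

theory Defs
  imports "HOL-Probability.Probability"
begin

text \<open>
  A family is given by a dominating measure \<open>M\<close>, a carrier density \<open>f0\<close> with respect to \<open>M\<close>, and a
  set \<open>A\<close> of canonical parameters. The carrier need not have total mass 1, and need not even be
  integrable.
\<close>

definition cumulant_gf :: "(real^'p) measure \<Rightarrow> (real^'p \<Rightarrow> real) \<Rightarrow> real^'p \<Rightarrow> real" where
  "cumulant_gf M f0 \<alpha> = ln (\<integral>x. exp (\<alpha> \<bullet> x) * f0 x \<partial>M)"

definition natural_parameter_space :: "(real^'p) measure \<Rightarrow> (real^'p \<Rightarrow> real) \<Rightarrow> (real^'p) set" where
  "natural_parameter_space M f0 = {\<alpha>. integrable M (\<lambda>x. exp (\<alpha> \<bullet> x) * f0 x)}"

definition canonical_density :: "(real^'p) measure \<Rightarrow> (real^'p \<Rightarrow> real) \<Rightarrow> real^'p \<Rightarrow> real^'p \<Rightarrow> real" where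
  "canonical_density M f0 \<alpha> x = exp (\<alpha> \<bullet> x - cumulant_gf M f0 \<alpha>) * f0 x"

definition canonical_distr :: "(real^'p) measure \<Rightarrow> (real^'p \<Rightarrow> real) \<Rightarrow> real^'p \<Rightarrow> (real^'p) measure" where
  "canonical_distr M f0 \<alpha> = density M (\<lambda>x. ennreal (canonical_density M f0 \<alpha> x))"

definition mean_vector :: "(real^'p) measure \<Rightarrow> (real^'p \<Rightarrow> real) \<Rightarrow> real^'p \<Rightarrow> real^'p" where
  "mean_vector M f0 \<alpha> = (\<integral>x. x \<partial>canonical_distr M f0 \<alpha>)"

definition covariance_matrix :: "(real^'p) measure \<Rightarrow> (real^'p \<Rightarrow> real) \<Rightarrow> real^'p \<Rightarrow> real^'p^'p" where
  "covariance_matrix M f0 \<alpha> =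
     (\<chi> i j. \<integral>x. (x $ i - mean_vector M f0 \<alpha> $ i) * (x $ j - mean_vector M f0 \<alpha> $ j)
               \<partial>canonical_distr M f0 \<alpha>)"

text \<open>
  Canonical parameters are taken in the interior of the natural parameter space. There \<open>cumulant_gf\<close>
  is smooth, all moments are finite, and \<open>mean_vector\<close> and \<open>covariance_matrix\<close> are its gradient and
  Hessian, so no separate moment or differentiability assumption is made.
\<close>

definition exponential_family :: "(real^'p) measure \<Rightarrow> (real^'p \<Rightarrow> real) \<Rightarrow> (real^'p) set \<Rightarrow> bool" where
  "exponential_family M f0 A \<longleftrightarrow>
     sets M = sets borel \<and>
     f0 \<in> borel_measurable M \<and> (\<forall>x. 0 \<le> f0 x) \<and> \<not> (AE x in M. f0 x = 0) \<and>
     A \<subseteq> interior (natural_parameter_space M f0) \<and>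
     inj_on (mean_vector M f0) A"

definition expectation_space :: "(real^'p) measure \<Rightarrow> (real^'p \<Rightarrow> real) \<Rightarrow> (real^'p) set \<Rightarrow> (real^'p) set" where
  "expectation_space M f0 A = mean_vector M f0 ` A"

definition canonical_param :: "(real^'p) measure \<Rightarrow> (real^'p \<Rightarrow> real) \<Rightarrow> (real^'p) set \<Rightarrow> real^'p \<Rightarrow> real^'p" where
  "canonical_param M f0 A \<beta> = the_inv_into A (mean_vector M f0) \<beta>"

definition family_density ::
  "(real^'p) measure \<Rightarrow> (real^'p \<Rightarrow> real) \<Rightarrow> (real^'p) set \<Rightarrow> real^'p \<Rightarrow> real^'p \<Rightarrow> real" where
  "family_density M f0 A \<beta> x = canonical_density M f0 (canonical_param M f0 A \<beta>) x"

text \<open>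
  Where \<open>f0\<close> vanishes the logarithm below is a junk value, but that set is null for the distribution
  with respect to which the expectation is taken.
\<close>

definition deviance ::
  "(real^'p) measure \<Rightarrow> (real^'p \<Rightarrow> real) \<Rightarrow> (real^'p) set \<Rightarrow> real^'p \<Rightarrow> real^'p \<Rightarrow> real" where
  "deviance M f0 A \<beta>1 \<beta>2 =
     2 * (\<integral>x. ln (family_density M f0 A \<beta>1 x / family_density M f0 A \<beta>2 x)
            \<partial>canonical_distr M f0 (canonical_param M f0 A \<beta>1))"

definition deviance_difference ::
  "(real^'p) measure \<Rightarrow> (real^'p \<Rightarrow> real) \<Rightarrow> (real^'p) set \<Rightarrow> real^'p \<Rightarrow> real^'p \<Rightarrow> real" where
  "deviance_difference M f0 A \<beta>hat \<beta> = (deviance M f0 A \<beta> \<beta>hat - deviance M f0 A \<beta>hat \<beta>) / 2"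

definition conversion_factor ::
  "(real^'p) measure \<Rightarrow> (real^'p \<Rightarrow> real) \<Rightarrow> (real^'p) set \<Rightarrow> real^'p \<Rightarrow> real^'p \<Rightarrow> real" where
  "conversion_factor M f0 A \<beta>hat \<beta> = family_density M f0 A \<beta> \<beta>hat / family_density M f0 A \<beta>hat \<beta>"

definition bootstrap_posterior_expectation ::
  "(real^'p) measure \<Rightarrow> (real^'p \<Rightarrow> real) \<Rightarrow> (real^'p) set \<Rightarrow> (real^'p \<Rightarrow> real) \<Rightarrow> real^'p \<Rightarrow>
   nat \<Rightarrow> (nat \<Rightarrow> real^'p) \<Rightarrow> (real^'p \<Rightarrow> real) \<Rightarrow> real" where
  "bootstrap_posterior_expectation M f0 A prior \<beta>hat B \<beta>s t =
     (\<Sum>i=1..B. t (\<beta>s i) * prior (\<beta>s i) * conversion_factor M f0 A \<beta>hat (\<beta>s i)) /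
     (\<Sum>i=1..B. prior (\<beta>s i) * conversion_factor M f0 A \<beta>hat (\<beta>s i))"

end

theory Submission
  imports Defs
begin

text \<open>
  Both densities entering a log likelihood ratio are exponentially tilted versions of the same carrier,
  so the ratio is affine in the observation and its expectation is obtained by substituting the mean
  vector. This gives the closed form of the deviance difference. Jeffreys prior turns the assumed
  ratio of the densities at their own means into the factor that makes prior times conversion factor
  proportional to the exponential of the deviance difference; the constant of proportionality cancels.
\<close>

text \<open>Finiteness of the mean, one direction at a time. At an interior \<alpha> the parameter
  can be moved a little both ways along \<open>b\<close>, and the two exponential tilts so obtained
  together dominate the linear factor \<open>x \<bullet> b\<close>.\<close>

lemma integrable_tilted_inner:
  fixes M :: "(real^'p) measure" and b :: "real^'p"
  assumes M: "sets M = sets borel"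
    and f0: "f0 \<in> borel_measurable M" "\<And>x. 0 \<le> f0 x"
    and \<alpha>: "\<alpha> \<in> interior (natural_parameter_space M f0)"
  shows "integrable M (\<lambda>x. exp (\<alpha> \<bullet> x) * f0 x * (x \<bullet> b))"
proof -
  note [measurable_cong] = M and [measurable] = f0(1)
  obtain e where e: "e > 0" "cball \<alpha> e \<subseteq> natural_parameter_space M f0"
    using \<alpha> mem_interior_cball by blast
  \<comment> \<open>Scaled so that \<alpha> shifted by \<plusminus> \<open>d *\<^sub>R b\<close>
    stays in the ball of radius \<open>e\<close>; the \<open>+ 1\<close> covers
    \<open>b = 0\<close>.\<close>
  define d where "d = e / (norm b + 1)"
  have pos: "norm b + 1 > 0"
    by (simp add: add_nonneg_pos)
  with e have d: "d > 0"
    by (simp add: d_def)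
  have "norm (d *\<^sub>R b) \<le> e"
    using e pos by (simp add: d_def pos_divide_le_eq)
  then have shift: "\<alpha> + d *\<^sub>R b \<in> natural_parameter_space M f0"
    "\<alpha> - d *\<^sub>R b \<in> natural_parameter_space M f0"
    using e by (auto simp: dist_norm subset_iff)
  \<comment> \<open>With \<open>y = d * (x \<bullet> b)\<close> this majorant factors as
    \<open>exp (\<alpha> \<bullet> x) * f0 x * (exp y + exp (- y)) / d\<close>, so comparing
    \<open>\<bar>y\<bar>\<close> with \<open>exp y + exp (- y)\<close> is enough.\<close>
  let ?g = "\<lambda>x. (exp ((\<alpha> + d *\<^sub>R b) \<bullet> x) * f0 x + exp ((\<alpha> - d *\<^sub>R b) \<bullet> x) * f0 x) / d"
  show ?thesis
  proof (rule Bochner_Integration.integrable_bound)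
    show "integrable M ?g"
      using shift by (simp add: natural_parameter_space_def)
    show "(\<lambda>x. exp (\<alpha> \<bullet> x) * f0 x * (x \<bullet> b)) \<in> borel_measurable M"
      by measurable
    have "norm (exp (\<alpha> \<bullet> x) * f0 x * (x \<bullet> b)) \<le> norm (?g x)" for x
    proof -
      let ?y = "d * (x \<bullet> b)"
      have "\<bar>?y\<bar> \<le> exp ?y + exp (- ?y)"
        using exp_ge_add_one_self[of ?y] exp_ge_add_one_self[of "- ?y"]
          exp_gt_zero[of ?y] exp_gt_zero[of "- ?y"] by linarith
      then have "\<bar>x \<bullet> b\<bar> \<le> (exp ?y + exp (- ?y)) / d"
        using d by (simp add: abs_mult field_simps)
      then have "exp (\<alpha> \<bullet> x) * f0 x * \<bar>x \<bullet> b\<bar>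
          \<le> exp (\<alpha> \<bullet> x) * f0 x * ((exp ?y + exp (- ?y)) / d)"
        using f0(2) by (intro mult_left_mono) auto
      also have "\<dots> = ?g x"
        by (simp add: inner_add_left inner_diff_left inner_commute[of b x] exp_add exp_diff
            exp_minus divide_inverse algebra_simps)
      finally show ?thesis
        using f0(2)[of x] d by (simp add: abs_mult)
    qed
    then show "AE x in M. norm (exp (\<alpha> \<bullet> x) * f0 x * (x \<bullet> b)) \<le> norm (?g x)"
      by simp
  qed
qed

text \<open>\<open>exp\<close> undoes \<open>ln\<close> only at a positive integral. A nonnegative
  integrand with integral 0 vanishes almost everywhere, which would force the carrier to vanish
  almost everywhere as well.\<close>

lemma exp_cumulant_gf:
  fixes M :: "(real^'p) measure"
  assumes f0: "\<And>x. 0 \<le> f0 x" "\<not> (AE x in M. f0 x = 0)"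
    and \<alpha>: "\<alpha> \<in> natural_parameter_space M f0"
  shows "exp (cumulant_gf M f0 \<alpha>) = (\<integral>x. exp (\<alpha> \<bullet> x) * f0 x \<partial>M)"
proof -
  have int: "integrable M (\<lambda>x. exp (\<alpha> \<bullet> x) * f0 x)"
    using \<alpha> by (simp add: natural_parameter_space_def)
  have "(\<integral>x. exp (\<alpha> \<bullet> x) * f0 x \<partial>M) \<noteq> 0"
    using f0 by (subst integral_nonneg_eq_0_iff_AE[OF int]) auto
  moreover have "(\<integral>x. exp (\<alpha> \<bullet> x) * f0 x \<partial>M) \<ge> 0"
    using f0 by (intro integral_nonneg_AE) auto
  ultimately show ?thesis
    by (simp add: cumulant_gf_def)
qed

context
  fixes M :: "(real^'p) measure" and f0 :: "real^'p \<Rightarrow> real" and A :: "(real^'p) set"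
  assumes family: "exponential_family M f0 A"
begin

lemma
  shows sets_dominating: "sets M = sets borel"
    and carrier_measurable: "f0 \<in> borel_measurable M"
    and carrier_nonneg: "0 \<le> f0 x"
    and carrier_not_AE_zero: "\<not> (AE x in M. f0 x = 0)"
    and interior_param: "\<alpha> \<in> A \<Longrightarrow> \<alpha> \<in> interior (natural_parameter_space M f0)"
    and inj_on_mean_vector: "inj_on (mean_vector M f0) A"
  using family by (auto simp: exponential_family_def)

lemma canonical_density_eq:
  "canonical_density M f0 \<alpha> x = exp (- cumulant_gf M f0 \<alpha>) * (exp (\<alpha> \<bullet> x) * f0 x)"
  by (simp add: canonical_density_def exp_diff exp_minus field_simps)

lemma canonical_density_nonneg: "0 \<le> canonical_density M f0 \<alpha> x"
  using carrier_nonneg by (simp add: canonical_density_def)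

lemma measurable_canonical_density: "canonical_density M f0 \<alpha> \<in> borel_measurable M"
proof -
  note [measurable_cong] = sets_dominating and [measurable] = carrier_measurable
  show ?thesis
    unfolding canonical_density_def[abs_def] by measurable
qed

lemma prob_space_canonical_distr:
  assumes "\<alpha> \<in> A"
  shows "prob_space (canonical_distr M f0 \<alpha>)"
proof -
  have \<alpha>: "\<alpha> \<in> natural_parameter_space M f0"
    using interior_param[OF assms] interior_subset by blast
  have int: "integrable M (canonical_density M f0 \<alpha>)"
    using \<alpha> by (simp add: canonical_density_eq[abs_def] natural_parameter_space_def)
  have "(\<integral>x. canonical_density M f0 \<alpha> x \<partial>M) = 1"
    \<comment> \<open>The normalizing factor leaves the integral, the remaining integral is
      rewritten as the exponential of the cumulant, and the two exponentials cancel.\<close>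
    by (simp add: canonical_density_eq mult_exp_exp
        flip: exp_cumulant_gf[OF carrier_nonneg carrier_not_AE_zero \<alpha>])
  then have "(\<integral>\<^sup>+x. ennreal (canonical_density M f0 \<alpha> x) \<partial>M) = 1"
    using canonical_density_nonneg by (simp add: nn_integral_eq_integral[OF int])
  then show ?thesis
    using measurable_canonical_density
    by (intro prob_spaceI)
      (simp add: canonical_distr_def emeasure_density cong: nn_integral_cong)
qed

text \<open>Makes \<open>mean_vector\<close> a genuine Bochner integral, through which inner
  products can be pulled. The vector is assembled from its \<open>Basis\<close> coordinates, each
  integrable by \<open>integrable_tilted_inner\<close>.\<close>

lemma integrable_canonical_distr_id:
  assumes "\<alpha> \<in> A"
  shows "integrable (canonical_distr M f0 \<alpha>) (\<lambda>x. x)"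
proof -
  note [measurable_cong] = sets_dominating
  have "integrable M (\<lambda>x. exp (- cumulant_gf M f0 \<alpha>) *\<^sub>R
      (\<Sum>b\<in>Basis. (exp (\<alpha> \<bullet> x) * f0 x * (x \<bullet> b)) *\<^sub>R b))"
    by (intro integrable_scaleR_right Bochner_Integration.integrable_sum integrable_scaleR_left
        integrable_tilted_inner sets_dominating carrier_measurable carrier_nonneg
        interior_param assms)
  also have "(\<lambda>x. exp (- cumulant_gf M f0 \<alpha>) *\<^sub>R
      (\<Sum>b\<in>Basis. (exp (\<alpha> \<bullet> x) * f0 x * (x \<bullet> b)) *\<^sub>R b)) =
      (\<lambda>x. canonical_density M f0 \<alpha> x *\<^sub>R x)"
  proof
    fix x :: "real^'p"
    have "(\<Sum>b\<in>Basis. (exp (\<alpha> \<bullet> x) * f0 x * (x \<bullet> b)) *\<^sub>R b) =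
        (exp (\<alpha> \<bullet> x) * f0 x) *\<^sub>R (\<Sum>b\<in>Basis. (x \<bullet> b) *\<^sub>R b)"
      by (simp only: scaleR_sum_right scaleR_scaleR)
    then show "exp (- cumulant_gf M f0 \<alpha>) *\<^sub>R
        (\<Sum>b\<in>Basis. (exp (\<alpha> \<bullet> x) * f0 x * (x \<bullet> b)) *\<^sub>R b) = canonical_density M f0 \<alpha> x *\<^sub>R x"
      by (simp only: euclidean_representation canonical_density_eq scaleR_scaleR)
  qed
  finally show ?thesis
    unfolding canonical_distr_def
    using canonical_density_nonneg measurable_canonical_density
    by (subst integrable_density) auto
qed

lemma expectation_log_ratio:
  assumes \<alpha>: "\<alpha> \<in> A"
  shows "(\<integral>x. ln (canonical_density M f0 \<alpha> x / canonical_density M f0 \<alpha>' x)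
            \<partial>canonical_distr M f0 \<alpha>) =
    (\<alpha> - \<alpha>') \<bullet> mean_vector M f0 \<alpha> - (cumulant_gf M f0 \<alpha> - cumulant_gf M f0 \<alpha>')"
proof -
  let ?P = "canonical_distr M f0 \<alpha>"
  let ?k = "cumulant_gf M f0 \<alpha> - cumulant_gf M f0 \<alpha>'"
  interpret P: prob_space ?P
    by (rule prob_space_canonical_distr[OF \<alpha>])
  have id: "integrable ?P (\<lambda>x. x)"
    by (rule integrable_canonical_distr_id[OF \<alpha>])
  have "canonical_density M f0 \<beta> \<in> borel_measurable ?P" for \<beta>
    by (simp add: canonical_distr_def measurable_canonical_density)
  note [measurable] = this
  \<comment> \<open>Positivity of the density excludes zeros of \<open>f0\<close>, where the
    quotient would be 0/0. Such points are null for \<open>?P\<close>, so the affine form holds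
    almost everywhere there.\<close>
  have ratio: "ln (canonical_density M f0 \<alpha> x / canonical_density M f0 \<alpha>' x) =
      (\<alpha> - \<alpha>') \<bullet> x - ?k" if "0 < canonical_density M f0 \<alpha> x" for x
  proof -
    have "f0 x \<noteq> 0"
      using that by (auto simp: canonical_density_def)
    then have "canonical_density M f0 \<alpha> x / canonical_density M f0 \<alpha>' x =
        exp ((\<alpha> - \<alpha>') \<bullet> x - ?k)"
      by (simp add: canonical_density_def inner_diff_left flip: exp_diff)
    then show ?thesis
      by simp
  qed
  have "AE x in ?P. ln (canonical_density M f0 \<alpha> x / canonical_density M f0 \<alpha>' x) =
      (\<alpha> - \<alpha>') \<bullet> x - ?k"
    unfolding canonical_distr_def
    by (subst AE_density) (use ratio measurable_canonical_density in auto)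
  then have "(\<integral>x. ln (canonical_density M f0 \<alpha> x / canonical_density M f0 \<alpha>' x) \<partial>?P) =
      (\<integral>x. (\<alpha> - \<alpha>') \<bullet> x - ?k \<partial>?P)"
    using borel_measurable_integrable[OF id] by (intro integral_cong_AE) simp_all
  also have "\<dots> = (\<alpha> - \<alpha>') \<bullet> mean_vector M f0 \<alpha> - ?k"
    using id by (simp add: mean_vector_def P.prob_space)
  finally show ?thesis .
qed

lemma
  assumes "\<beta> \<in> expectation_space M f0 A"
  shows canonical_param_in: "canonical_param M f0 A \<beta> \<in> A"
    and mean_vector_canonical_param: "mean_vector M f0 (canonical_param M f0 A \<beta>) = \<beta>"
  using assms inj_on_mean_vector unfolding canonical_param_def expectation_space_def
  by (auto simp: the_inv_into_f_f)

lemma deviance_eq: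
  assumes "\<beta>1 \<in> expectation_space M f0 A"
  shows "deviance M f0 A \<beta>1 \<beta>2 =
    2 * ((canonical_param M f0 A \<beta>1 - canonical_param M f0 A \<beta>2) \<bullet> \<beta>1
      - (cumulant_gf M f0 (canonical_param M f0 A \<beta>1)
         - cumulant_gf M f0 (canonical_param M f0 A \<beta>2)))"
  using expectation_log_ratio[OF canonical_param_in[OF assms]] mean_vector_canonical_param[OF assms]
  by (simp add: deviance_def family_density_def)

text \<open>Exchanging the two arguments flips the sign of both the parameter difference and the
  cumulant difference. Subtraction therefore adds the two means and doubles the cumulant
  term.\<close>

lemma deviance_difference_eq:
  assumes "\<beta>hat \<in> expectation_space M f0 A" "\<beta> \<in> expectation_space M f0 A"
  shows "deviance_difference M f0 A \<beta>hat \<beta> =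
    (canonical_param M f0 A \<beta> - canonical_param M f0 A \<beta>hat) \<bullet> (\<beta> + \<beta>hat)
    - 2 * (cumulant_gf M f0 (canonical_param M f0 A \<beta>)
           - cumulant_gf M f0 (canonical_param M f0 A \<beta>hat))"
  using assms
  by (simp add: deviance_difference_def deviance_eq inner_add_right inner_diff_left field_simps)

text \<open>After cross-multiplication each side carries the same product
  \<open>f0 \<beta>hat * f0 \<beta>\<close>; once it is cancelled, only an identity between
  exponents remains. The prefactor is the ratio that the theorem's assumption expresses by
  determinants.\<close>

lemma conversion_factor_eq:
  assumes "\<beta>hat \<in> expectation_space M f0 A" "\<beta> \<in> expectation_space M f0 A"
    and "f0 \<beta>hat > 0" "f0 \<beta> > 0"
  shows "conversion_factor M f0 A \<beta>hat \<beta> =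
    family_density M f0 A \<beta>hat \<beta>hat / family_density M f0 A \<beta> \<beta> *
    exp (deviance_difference M f0 A \<beta>hat \<beta>)"
proof -
  let ?\<alpha> = "canonical_param M f0 A \<beta>" and ?\<alpha>hat = "canonical_param M f0 A \<beta>hat"
  let ?\<psi> = "cumulant_gf M f0 ?\<alpha>" and ?\<psi>hat = "cumulant_gf M f0 ?\<alpha>hat"
  have "exp (?\<alpha> \<bullet> \<beta>hat - ?\<psi>) * exp (?\<alpha> \<bullet> \<beta> - ?\<psi>) =
      exp (?\<alpha>hat \<bullet> \<beta>hat - ?\<psi>hat) * exp (deviance_difference M f0 A \<beta>hat \<beta>) *
      exp (?\<alpha>hat \<bullet> \<beta> - ?\<psi>hat)"
    unfolding deviance_difference_eq[OF assms(1,2)] exp_add[symmetric]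
    by (simp add: inner_add_right inner_diff_left)
  then show ?thesis
    using assms(3,4)
    by (simp add: conversion_factor_def family_density_def canonical_density_def field_simps)
qed

end

theorem lemma2:
  fixes M :: "(real^'p) measure"
    and f0 :: "real^'p \<Rightarrow> real"
    and A :: "(real^'p) set"
    and \<beta>hat :: "real^'p"
    and B :: nat
    and \<beta>s :: "nat \<Rightarrow> real^'p"
    and t prior :: "real^'p \<Rightarrow> real"
    and c :: real
  assumes family: "exponential_family M f0 A"
    and positive: "\<And>\<beta> x. \<beta> \<in> expectation_space M f0 A \<Longrightarrow> x \<in> expectation_space M f0 A \<Longrightarrow>
          family_density M f0 A \<beta> x > 0"
    and nonsingular: "\<And>\<alpha>. \<alpha> \<in> A \<Longrightarrow> invertible (covariance_matrix M f0 \<alpha>)"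
    and observed: "\<beta>hat \<in> expectation_space M f0 A"
    and density_ratio: "\<And>\<beta>. \<beta> \<in> expectation_space M f0 A \<Longrightarrow>
          family_density M f0 A \<beta>hat \<beta>hat / family_density M f0 A \<beta> \<beta> =
          det (covariance_matrix M f0 (canonical_param M f0 A \<beta>)) powr (1/2) /
          det (covariance_matrix M f0 (canonical_param M f0 A \<beta>hat)) powr (1/2)"
    and B_pos: "1 \<le> B"
    and replications: "\<And>i. i \<in> {1..B} \<Longrightarrow> \<beta>s i \<in> expectation_space M f0 A"
    and c_pos: "c > 0"
    and jeffreys: "\<And>\<beta>. \<beta> \<in> expectation_space M f0 A \<Longrightarrow>
          prior \<beta> = c * det (covariance_matrix M f0 (canonical_param M f0 A \<beta>)) powr (-1/2)"
  shows "bootstrap_posterior_expectation M f0 A prior \<beta>hat B \<beta>s t =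
           (\<Sum>i=1..B. t (\<beta>s i) * exp (deviance_difference M f0 A \<beta>hat (\<beta>s i))) /
           (\<Sum>i=1..B. exp (deviance_difference M f0 A \<beta>hat (\<beta>s i)))
       \<and> (\<forall>\<beta>\<in>expectation_space M f0 A.
            deviance_difference M f0 A \<beta>hat \<beta> =
              (canonical_param M f0 A \<beta> - canonical_param M f0 A \<beta>hat) \<bullet> (\<beta> + \<beta>hat)
              - 2 * (cumulant_gf M f0 (canonical_param M f0 A \<beta>)
                     - cumulant_gf M f0 (canonical_param M f0 A \<beta>hat)))"
proof
  let ?E = "expectation_space M f0 A"
  let ?\<Delta> = "deviance_difference M f0 A \<beta>hat"
  let ?d = "\<lambda>\<beta>. det (covariance_matrix M f0 (canonical_param M f0 A \<beta>))"
  \<comment> \<open>What survives of the prior and the density ratio once the determinant at \<beta>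
    has cancelled; it is the same for every replication.\<close>
  define C where "C = c / ?d \<beta>hat powr (1/2)"
  have d: "?d \<beta> \<noteq> 0" if "\<beta> \<in> ?E" for \<beta>
    using nonsingular[OF canonical_param_in[OF family that]] by (simp add: invertible_det_nz)
  have f0: "f0 \<beta> > 0" if "\<beta> \<in> ?E" for \<beta>
    using positive[OF that that]
    by (simp add: family_density_def canonical_density_def zero_less_mult_iff)
  \<comment> \<open>\<open>powr\<close> vanishes only at base 0, so nonsingularity at the observed
    value keeps the denominator of \<open>C\<close> away from 0.\<close>
  have C: "C \<noteq> 0"
    using c_pos d[OF observed] by (simp add: C_def)
  have weight: "prior \<beta> * conversion_factor M f0 A \<beta>hat \<beta> = C * exp (?\<Delta> \<beta>)" if \<beta>: "\<beta> \<in> ?E" for \<beta>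
  proof -
    \<comment> \<open>The exponents add to 0, and \<open>x powr 0\<close> is 1 exactly when
      \<open>x\<close> is nonzero. This is how Jeffreys prior absorbs the determinant at
      \<beta>.\<close>
    have "?d \<beta> powr (-1/2) * ?d \<beta> powr (1/2) = 1"
      using d[OF \<beta>] by (simp flip: powr_add)
    moreover have "conversion_factor M f0 A \<beta>hat \<beta> =
        ?d \<beta> powr (1/2) / ?d \<beta>hat powr (1/2) * exp (?\<Delta> \<beta>)"
      using conversion_factor_eq[OF family observed \<beta> f0[OF observed] f0[OF \<beta>]]
      by (simp only: density_ratio[OF \<beta>])
    ultimately show ?thesis
      by (simp add: jeffreys[OF \<beta>] C_def)
  qed
  have "(\<Sum>i=1..B. t (\<beta>s i) * prior (\<beta>s i) * conversion_factor M f0 A \<beta>hat (\<beta>s i)) =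
      C * (\<Sum>i=1..B. t (\<beta>s i) * exp (?\<Delta> (\<beta>s i)))"
    unfolding sum_distrib_left
    by (intro sum.cong refl) (simp add: weight replications mult.assoc mult.left_commute)
  moreover have "(\<Sum>i=1..B. prior (\<beta>s i) * conversion_factor M f0 A \<beta>hat (\<beta>s i)) =
      C * (\<Sum>i=1..B. exp (?\<Delta> (\<beta>s i)))"
    unfolding sum_distrib_left by (intro sum.cong refl weight replications)
  \<comment> \<open>Numerator and denominator share the factor \<open>C\<close>; its being nonzero
    licenses the cancellation.\<close>
  ultimately show "bootstrap_posterior_expectation M f0 A prior \<beta>hat B \<beta>s t =
      (\<Sum>i=1..B. t (\<beta>s i) * exp (?\<Delta> (\<beta>s i))) / (\<Sum>i=1..B. exp (?\<Delta> (\<beta>s i)))"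
    using C by (simp add: bootstrap_posterior_expectation_def)
qed (use deviance_difference_eq[OF family observed] in blast)

end
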